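(* Let $(X,\delta)$ be a finite diversity with tight span $(T_X,\delta_T)$ and canonical embedding $\kappa:X\to T_X$. For every solution $(T,w)$ to the diversity Steiner problem for $(X,\delta)$ there is a map $\phi:V(T)\to T_X$ such that $\phi(x)=\kappa(x)$ for all $x\in X$ and $w(\{u,v\})=\delta_T(\{\phi(u),\phi(v)\})$ for all $\{u,v\}\in E(T)$.
   Context: For a set $X$, $\mathcal{P}_{\mathrm{fin}}(X)$ denotes the set of all finite subsets of $X$. A diversity is a pair $(X,\delta)$ where $X$ is a set and $\delta:\mathcal{P}_{\mathrm{fin}}(X)\to\mathbb{R}$ satisfies, for all finite $A,B,C\subseteq X$: (D1) $\delta(A)\ge 0$, and $\delta(A)=0$ if and only if $|A|\le 1$; (D2) if $B\ne\emptyset$ then $\delta(A\cup C)\le\delta(A\cup B)+\delta(B\cup C)$. It is finite if $X$ is finite. Given a diversity $(X,\delta)$, $P_X$ is the set of all functions $f:\mathcal{P}_{\mathrm{fin}}(X)\to\mathbb{R}$ with $f(\emptyset)=0$ and $\sum_{A\in\mathscr{A}}f(A)\ge\delta\big(\bigcup_{A\in\mathscr{A}}A\big)$ for all finite $\mathscr{A}\subseteq\mathcal{P}_{\mathrm{fin}}(X)$. Write $f\preceq g$ if $f(A)\le g(A)$ for all finite $A\subseteq X$. The tight span $T_X$ is the set of elements of $P_X$ that are minimal with respect to $\preceq$, and $\delta_T:\mathcal{P}_{\mathrm{fin}}(T_X)\to\mathbb{R}$ is defined by $\delta_T(\emptyset)=0$ and, for finite non-empty $F\subseteq T_X$, $$\delta_T(F)=\sup\left\{\delta\Big(\bigcup_{A\in\mathscr{A}}A\Big)-\sum_{A\in\mathscr{A}}\inf_{f\in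 F}f(A):\ \mathscr{A}\subseteq\mathcal{P}_{\mathrm{fin}}(X),\ |\mathscr{A}|<\infty\right\}.$$ The pair $(T_X,\delta_T)$ is a diversity. The canonical embedding $\kappa:X\to T_X$ sends $x$ to $h_x$, where $h_x(A)=\delta(A\cup\{x\})$ for finite $A\subseteq X$. For a (finite) tree $T$ with edge weights $w:E(T)\to\mathbb{R}_{\ge 0}$ and $A\subseteq V(T)$, $\delta_w(A)$ denotes the sum of the edge weights in the smallest subtree of $T$ connecting $A$. Diversity Steiner problem: given a finite diversity $(X,\delta)$, find a (graph-theoretic, finite) tree $T$ and edge weighting $w:E(T)\to\mathbb{R}_{\ge 0}$ such that $X\subseteq V(T)$, $\delta_w(Y)\ge\delta(Y)$ for all $Y\subseteq X$, and $\sum_{e\in E(T)}w(e)$ is minimised. A solution is a pair $(T,w)$ attaining this minimum. *)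

theory Defs
  imports Complex_Main "HOL-Library.FuncSet"
begin

section \<open>Diversities and their tight spans\<close>

text \<open>The value of \<open>\<delta>\<close> is only relevant on \<^term>\<open>Fpow X\<close>, the finite subsets of \<open>X\<close>.\<close>

locale diversity =
  fixes X :: "'a set" and \<delta> :: "'a set \<Rightarrow> real"
  assumes nonneg: "A \<in> Fpow X \<Longrightarrow> 0 \<le> \<delta> A"
    and zero_iff: "A \<in> Fpow X \<Longrightarrow> \<delta> A = 0 \<longleftrightarrow> card A \<le> 1"
    and triangle: "A \<in> Fpow X \<Longrightarrow> B \<in> Fpow X \<Longrightarrow> C \<in> Fpow X \<Longrightarrow> B \<noteq> {} \<Longrightarrow>
      \<delta> (A \<union> C) \<le> \<delta> (A \<union> B) + \<delta> (B \<union> C)"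

text \<open>
  Functions on the finite subsets of \<open>X\<close> are represented by functions on the type
  \<^typ>\<open>'a set\<close> that are \<^const>\<open>undefined\<close> outside \<^term>\<open>Fpow X\<close>, so that HOL equality
  is equality of functions on \<^term>\<open>Fpow X\<close>.
\<close>

definition div_P :: "'a set \<Rightarrow> ('a set \<Rightarrow> real) \<Rightarrow> ('a set \<Rightarrow> real) set" where
  "div_P X \<delta> = {f \<in> extensional (Fpow X). f {} = 0 \<and>
     (\<forall>\<A> \<in> Fpow (Fpow X). \<delta> (\<Union>\<A>) \<le> (\<Sum>A\<in>\<A>. f A))}"

definition div_le :: "'a set \<Rightarrow> ('a set \<Rightarrow> real) \<Rightarrow> ('a set \<Rightarrow> real) \<Rightarrow> bool" where
  "div_le X f g \<longleftrightarrow> (\<forall>A \<in> Fpow X. f A \<le> g A)"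

definition tight_span :: "'a set \<Rightarrow> ('a set \<Rightarrow> real) \<Rightarrow> ('a set \<Rightarrow> real) set" where
  "tight_span X \<delta> = {f \<in> div_P X \<delta>. \<forall>g \<in> div_P X \<delta>. div_le X g f \<longrightarrow> g = f}"

definition tight_span_div ::
    "'a set \<Rightarrow> ('a set \<Rightarrow> real) \<Rightarrow> ('a set \<Rightarrow> real) set \<Rightarrow> real" where
  "tight_span_div X \<delta> F = (if F = {} then 0
     else (SUP \<A> \<in> Fpow (Fpow X). \<delta> (\<Union>\<A>) - (\<Sum>A\<in>\<A>. INF f\<in>F. f A)))"

definition kappa :: "'a set \<Rightarrow> ('a set \<Rightarrow> real) \<Rightarrow> 'a \<Rightarrow> 'a set \<Rightarrow> real" where
  "kappa X \<delta> x = (\<lambda>A \<in> Fpow X. \<delta> (A \<union> {x}))"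


section \<open>Finite trees\<close>

text \<open>A simple graph is a vertex set together with a set of two-element sets of vertices.\<close>

definition simple_graph :: "'v set \<Rightarrow> 'v set set \<Rightarrow> bool" where
  "simple_graph V E \<longleftrightarrow> (\<forall>e\<in>E. \<exists>u\<in>V. \<exists>v\<in>V. u \<noteq> v \<and> e = {u, v})"

definition walk :: "'v set \<Rightarrow> 'v set set \<Rightarrow> 'v list \<Rightarrow> bool" where
  "walk V E p \<longleftrightarrow> p \<noteq> [] \<and> set p \<subseteq> V \<and> (\<forall>i. Suc i < length p \<longrightarrow> {p ! i, p ! Suc i} \<in> E)"

definition cycle :: "'v set \<Rightarrow> 'v set set \<Rightarrow> 'v list \<Rightarrow> bool" where
  "cycle V E p \<longleftrightarrow> walk V E p \<and> 3 \<le> length p \<and> distinct p \<and> {last p, hd p} \<in> E"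

definition connected_graph :: "'v set \<Rightarrow> 'v set set \<Rightarrow> bool" where
  "connected_graph V E \<longleftrightarrow>
     V \<noteq> {} \<and> (\<forall>u\<in>V. \<forall>v\<in>V. \<exists>p. walk V E p \<and> hd p = u \<and> last p = v)"

definition finite_tree :: "'v set \<Rightarrow> 'v set set \<Rightarrow> bool" where
  "finite_tree V E \<longleftrightarrow>
     finite V \<and> simple_graph V E \<and> connected_graph V E \<and> (\<nexists>p. cycle V E p)"

definition subtree :: "'v set \<Rightarrow> 'v set set \<Rightarrow> 'v set \<Rightarrow> 'v set set \<Rightarrow> bool" where
  "subtree U F V E \<longleftrightarrow> U \<subseteq> V \<and> F \<subseteq> E \<and> finite_tree U F"

text \<open>
  In a tree, the subtrees containing a fixed non-empty set \<open>A\<close> of vertices are closed under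
  intersection, so the intersection of their edge sets is the edge set of the smallest
  one. For \<open>A = {}\<close> the intersection has no edges, since single vertices are subtrees.
\<close>

definition span_edges :: "'v set \<Rightarrow> 'v set set \<Rightarrow> 'v set \<Rightarrow> 'v set set" where
  "span_edges V E A = \<Inter> {F. \<exists>U. subtree U F V E \<and> A \<subseteq> U}"

definition tree_div ::
    "'v set \<Rightarrow> 'v set set \<Rightarrow> ('v set \<Rightarrow> real) \<Rightarrow> 'v set \<Rightarrow> real" where
  "tree_div V E w A = (\<Sum>e \<in> span_edges V E A. w e)"


section \<open>The diversity Steiner problem\<close>

text \<open>
  The map \<open>\<iota>\<close> identifies \<open>X\<close> with a set of vertices of the tree; for a tree on the same type
  as \<open>X\<close> it is taken to be the identity, and then the condition on \<open>\<iota>\<close> says \<open>X \<subseteq> V\<close>.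
\<close>

definition steiner_feasible ::
    "'a set \<Rightarrow> ('a set \<Rightarrow> real) \<Rightarrow> ('a \<Rightarrow> 'v) \<Rightarrow>
     'v set \<Rightarrow> 'v set set \<Rightarrow> ('v set \<Rightarrow> real) \<Rightarrow> bool" where
  "steiner_feasible X \<delta> \<iota> V E w \<longleftrightarrow>
     finite_tree V E \<and> (\<forall>e\<in>E. 0 \<le> w e) \<and>
     inj_on \<iota> X \<and> \<iota> ` X \<subseteq> V \<and>
     (\<forall>Y \<subseteq> X. \<delta> Y \<le> tree_div V E w (\<iota> ` Y))"

text \<open>
  The competitors range over all finite trees containing a copy of \<open>X\<close>, whatever their
  number of vertices. Ranging over trees on the type \<open>'a\<close> instead would exclude competitors
  when \<open>'a\<close> is finite; every finite tree is isomorphic to one with vertices of type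
  \<^typ>\<open>nat\<close>.
\<close>

definition steiner_solution ::
    "'a set \<Rightarrow> ('a set \<Rightarrow> real) \<Rightarrow> 'a set \<Rightarrow> 'a set set \<Rightarrow> ('a set \<Rightarrow> real) \<Rightarrow> bool" where
  "steiner_solution X \<delta> V E w \<longleftrightarrow>
     steiner_feasible X \<delta> (\<lambda>x. x) V E w \<and>
     (\<forall>(\<iota> :: 'a \<Rightarrow> nat) V' E' w'. steiner_feasible X \<delta> \<iota> V' E' w' \<longrightarrow>
        (\<Sum>e\<in>E. w e) \<le> (\<Sum>e\<in>E'. w' e))"

end

theory Submission
  imports Defs
begin

text \<open>
  The tight span is an injective object: non-expansive maps into it extend. Let \<open>D = tree_div V E w\<close>
  be the tree diversity of a solution. As \<open>\<delta> \<le> D\<close> on \<open>X\<close>, the canonical embedding is non-expansive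
  from \<open>(X, D)\<close>, and extends to a map \<open>\<phi>\<close> from \<open>V\<close> to the tight span under which the distance of the
  images of \<open>u\<close> and \<open>v\<close> is at most \<open>D {u, v}\<close>, hence at most \<open>w {u, v}\<close> on an edge. Now reweight
  every edge of the tree by the distance of the images of its ends. The new weights are still feasible,
  because the tight span diversity satisfies the triangle inequality along every subtree and
  restricts to \<open>\<delta>\<close> on \<open>X\<close>. No weight has grown and the total weight was minimal, so no weight has
  changed, which is the claim.

  For the extension (\<open>exists_nonexpansive_extension\<close>), the whole map is found at once as a family
  \<open>F v A\<close> of reals, for \<open>v \<in> V\<close> and \<open>A \<subseteq> X\<close>, subject to the finitely many constraints
  \<open>\<delta> (\<Union>(snd ` S)) \<le> (\<Sum>(v, A)\<in>S. F v A) + D (fst ` S)\<close> for \<open>S \<subseteq> V \<times> Pow X\<close>. One such family lies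
  below \<open>kappa X \<delta> x\<close> at each \<open>x \<in> X\<close> (\<open>initial_covers\<close>). Lowering its entries one after the other
  until each occurs in an equality (\<open>lower_to_tight\<close>) gives a family whose members \<open>F v\<close> are each
  minimal on their own: an equality that involves several vertices is turned into an equality at a
  single vertex by the triangle inequality for \<open>D\<close> (\<open>exists_tight_family\<close>). The constraints on
  two vertices are the distance bounds.

  For the feasibility of the new weights (\<open>tight_tree_dominates\<close>), the proof rests on two properties of
  the tight span: its elements are subadditive, and \<open>f A - g A\<close> is at most the distance of \<open>f\<close>
  and \<open>g\<close>. The required inequality is then proved by growing the tree from a root, one edge at
  a time (\<open>tight_tree_bound\<close>). The edges of the smallest subtree that connects \<open>A\<close> are throughout described
  as the edges whose removal separates two points of \<open>A\<close> (\<open>span_edges_eq_separating\<close>).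
\<close>

section \<open>Tight solutions of covering constraints\<close>

text \<open>
  Lowering one coordinate to the largest value that the constraints force on it makes it tight.
  Lowering another one later cannot increase the sum in an equality, and cannot
  decrease it either, so a coordinate that is tight stays tight, and one pass over \<open>I\<close> suffices.
\<close>

lemma lower_to_tight:
  fixes F :: "'i \<Rightarrow> real"
  assumes I: "finite I" and F: "\<forall>S\<subseteq>I. c S \<le> sum F S"
  shows "\<exists>G. (\<forall>i. G i \<le> F i) \<and> (\<forall>S\<subseteq>I. c S \<le> sum G S) \<and>
    (\<forall>i\<in>I. \<exists>S\<subseteq>I. i \<in> S \<and> sum G S = c S)"
proof -
  have "\<exists>G. (\<forall>i. G i \<le> F i) \<and> (\<forall>S\<subseteq>I. c S \<le> sum G S) \<and>
      (\<forall>i\<in>J. \<exists>S\<subseteq>I. i \<in> S \<and> sum G S = c S)" if "finite J" "J \<subseteq> I" for J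
    using that
  proof (induction J)
    case empty
    show ?case using F by (intro exI[of _ F]) simp
  next
    case (insert j J)
    obtain G where G: "\<forall>i. G i \<le> F i" "\<forall>S\<subseteq>I. c S \<le> sum G S"
      "\<forall>i\<in>J. \<exists>S\<subseteq>I. i \<in> S \<and> sum G S = c S"
      using insert.IH insert.prems by auto
    let ?K = "{S. S \<subseteq> I \<and> j \<in> S}"
    define slack where "slack = (\<lambda>S. sum G S - c S)"
    define m where "m = Min (slack ` ?K)"
    have K: "finite ?K" "I \<in> ?K" using I insert.prems by auto
    then have m_le: "m \<le> slack S" if "S \<in> ?K" for S
      using that unfolding m_def by (intro Min_le) auto
    have "m \<in> slack ` ?K" unfolding m_def using K by (intro Min_in) auto
    then obtain S\<^sub>0 where S\<^sub>0: "S\<^sub>0 \<subseteq> I" "j \<in> S\<^sub>0" "m = slack S\<^sub>0" by auto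
    have m0: "0 \<le> m" using S\<^sub>0 G(2) by (auto simp: slack_def)
    define H where "H = G(j := G j - m)"
    have sum_H: "sum H S = sum G S - (if j \<in> S then m else 0)" if "S \<subseteq> I" for S
    proof -
      have "finite S" using that I finite_subset by blast
      then have "sum H S = (\<Sum>i\<in>S. G i - (if i = j then m else 0))"
        unfolding H_def by (intro sum.cong) auto
      also have "\<dots> = sum G S - (if j \<in> S then m else 0)"
        using \<open>finite S\<close> by (simp add: sum_subtractf)
      finally show ?thesis .
    qed
    have "H i \<le> F i" for i using G(1)[rule_format, of i] m0 by (auto simp: H_def)
    moreover have "c S \<le> sum H S" if "S \<subseteq> I" for S
      using that sum_H[OF that] G(2) m_le[of S] by (auto simp: slack_def)
    moreover have "\<exists>S\<subseteq>I. i \<in> S \<and> sum H S = c S" if i: "i \<in> insert j J" for i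
    proof (cases "i = j")
      case True
      then show ?thesis using S\<^sub>0 sum_H[of S\<^sub>0] by (intro exI[of _ "S\<^sub>0"]) (simp add: slack_def)
    next
      case False
      then have "i \<in> J" using i by simp
      then obtain S where S: "S \<subseteq> I" "i \<in> S" "sum G S = c S" using G(3) by blast
      then have "j \<in> S \<Longrightarrow> m = 0" using m_le[of S] m0 by (auto simp: slack_def)
      then show ?thesis using S sum_H[of S] by (intro exI[of _ S]) simp
    qed
    ultimately show ?case by (intro exI[of _ H] conjI allI impI ballI)
  qed
  from this[OF I order_refl] show ?thesis .
qed


section \<open>Reachability and separating edges in finite trees\<close>

abbreviation reach :: "'v set set \<Rightarrow> 'v \<Rightarrow> 'v \<Rightarrow> bool" where
  "reach E u v \<equiv> (u, v) \<in> {(u, v). {u, v} \<in> E}\<^sup>*"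

lemma reach_sym: "reach E u v \<Longrightarrow> reach E v u"
  by (rule symD[OF sym_rtrancl]) (auto simp: sym_def insert_commute)

lemma reach_mono: "reach E u v \<Longrightarrow> E \<subseteq> F \<Longrightarrow> reach F u v"
  using rtrancl_mono[of "{(u, v). {u, v} \<in> E}" "{(u, v). {u, v} \<in> F}"] by auto

lemma reach_edge: "{u, v} \<in> E \<Longrightarrow> reach E u v"
  by (rule r_into_rtrancl) auto

lemma walk_iff:
  "walk V E p \<longleftrightarrow> p \<noteq> [] \<and> set p \<subseteq> V \<and> successively (\<lambda>u v. {u, v} \<in> E) p"
  unfolding walk_def successively_conv_nth by auto

lemma walk_reach: "walk V E p \<Longrightarrow> reach E (hd p) (last p)"
proof (induction p)
  case Nil
  then show ?case by (simp add: walk_iff)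
next
  case (Cons x p)
  show ?case
  proof (cases "p = []")
    case False
    then have "{x, hd p} \<in> E" "walk V E p"
      using Cons.prems by (auto simp: walk_iff successively_Cons)
    then have "reach E (hd p) (last p)" "reach E x (hd p)"
      using Cons.IH reach_edge by auto
    then show ?thesis using False by (auto intro: rtrancl_trans[of x "hd p"])
  qed auto
qed

lemma reach_imp_path:
  assumes "reach E u v" "simple_graph V E" "v \<in> V"
  shows "\<exists>p. walk V E p \<and> distinct p \<and> hd p = u \<and> last p = v"
  using assms(1)
proof (induction rule: converse_rtrancl_induct)
  case base
  then show ?case using assms(3) by (intro exI[of _ "[v]"]) (auto simp: walk_iff)
next
  case (step u y)
  then obtain p where p: "walk V E p" "distinct p" "hd p = y" "last p = v" by auto
  have uV: "u \<in> V" using step(1) assms(2) by (auto simp: simple_graph_def doubleton_eq_iff dest!: bspec)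
  show ?case
  proof (cases "u \<in> set p")
    case True
    then obtain q r where "p = q @ u # r" by (auto simp: in_set_conv_decomp)
    then show ?thesis using p
      by (intro exI[of _ "u # r"]) (auto simp: walk_iff successively_append_iff)
  next
    case False
    then show ?thesis using p step(1) uV
      by (intro exI[of _ "u # p"]) (auto simp: walk_iff successively_Cons)
  qed
qed

lemma finite_tree_edges: "finite_tree V E \<Longrightarrow> e \<in> E \<Longrightarrow> \<exists>u\<in>V. \<exists>v\<in>V. u \<noteq> v \<and> e = {u, v}"
  by (auto simp: finite_tree_def simple_graph_def)

lemma finite_tree_finite_edges:
  assumes "finite_tree V E" shows "finite E"
proof (rule finite_subset)
  show "E \<subseteq> Pow V" using finite_tree_edges[OF assms] by blast
  show "finite (Pow V)" using assms by (simp add: finite_tree_def)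
qed

lemma finite_tree_reach:
  assumes "finite_tree V E" "u \<in> V" "v \<in> V" shows "reach E u v"
  using assms walk_reach unfolding finite_tree_def connected_graph_def by metis

lemma finite_treeI_reach:
  assumes "finite V" "V \<noteq> {}" "simple_graph V E" "\<nexists>p. cycle V E p"
    "\<And>u v. u \<in> V \<Longrightarrow> v \<in> V \<Longrightarrow> reach E u v"
  shows "finite_tree V E"
  unfolding finite_tree_def connected_graph_def
proof (intro conjI ballI)
  show "\<exists>p. walk V E p \<and> hd p = u \<and> last p = v" if "u \<in> V" "v \<in> V" for u v
    using reach_imp_path[OF assms(5)[OF that] assms(3) that(2)] by blast
qed (use assms in auto)

lemma cycle_mono: "cycle U F p \<Longrightarrow> U \<subseteq> V \<Longrightarrow> F \<subseteq> E \<Longrightarrow> cycle V E p"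
  unfolding cycle_def walk_def by blast

text \<open>A detour from \<open>p\<close> to \<open>q\<close> would close a cycle with the edge.\<close>

lemma tree_edge_separates:
  assumes T: "finite_tree V E" and e: "{p, q} \<in> E"
  shows "\<not> reach (E - {{p, q}}) p q"
proof
  let ?E = "E - {{p, q}}"
  assume r: "reach ?E p q"
  have pq: "p \<noteq> q" "q \<in> V" using finite_tree_edges[OF T e] by (auto simp: doubleton_eq_iff)
  have "simple_graph V ?E" using T by (auto simp: finite_tree_def simple_graph_def)
  then obtain ps where ps: "walk V ?E ps" "distinct ps" "hd ps = p" "last ps = q"
    using reach_imp_path[OF r] pq by blast
  have "3 \<le> length ps"
  proof (rule ccontr)
    assume "\<not> 3 \<le> length ps"
    then have "length ps = 0 \<or> length ps = 1 \<or> length ps = 2" by linarith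
    then have "ps = [] \<or> (\<exists>x. ps = [x]) \<or> (\<exists>x y. ps = [x, y])"
      by (auto simp: length_Suc_conv numeral_2_eq_2)
    then show False using ps pq by (auto simp: walk_iff)
  qed
  moreover have "walk V E ps" using ps(1) by (auto simp: walk_def)
  ultimately have "cycle V E ps" using ps e by (auto simp: cycle_def insert_commute)
  then show False using T by (auto simp: finite_tree_def)
qed

text \<open>
  A subtree that connects two points separated by \<open>e\<close> must use \<open>e\<close>. Conversely, if \<open>e\<close> separates no
  two points of \<open>A\<close>, then \<open>A\<close> lies in one component of the tree without \<open>e\<close>, and that component
  is a subtree that avoids \<open>e\<close>. With this description, inclusions between
  spans reduce to the transitivity of reachability.
\<close>

lemma span_edges_eq_separating:
  assumes T: "finite_tree V E" and A: "A \<subseteq> V"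
  shows "span_edges V E A = {e \<in> E. \<exists>a\<in>A. \<exists>b\<in>A. \<not> reach (E - {e}) a b}" (is "_ = ?R")
proof (intro equalityI subsetI)
  fix e assume e: "e \<in> ?R"
  then obtain a b where ab: "a \<in> A" "b \<in> A" "\<not> reach (E - {e}) a b" by auto
  have "e \<in> F" if "subtree U F V E" "A \<subseteq> U" for U F
  proof (rule ccontr)
    assume "e \<notin> F"
    have "finite_tree U F" "F \<subseteq> E" using that(1) by (auto simp: subtree_def)
    then have "reach F a b" "F \<subseteq> E - {e}"
      using finite_tree_reach[of U F a b] ab that(2) \<open>e \<notin> F\<close> by auto
    then show False using ab(3) reach_mono[of a b F "E - {e}"] by simp
  qed
  then show "e \<in> span_edges V E A" by (auto simp: span_edges_def)
next
  fix e assume e: "e \<in> span_edges V E A"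
  have V: "finite V" "V \<noteq> {}" "simple_graph V E" "\<nexists>p. cycle V E p"
    using T by (auto simp: finite_tree_def connected_graph_def)
  have "subtree V E V E" using T by (simp add: subtree_def)
  then have eE: "e \<in> E" using e A by (auto simp: span_edges_def)
  show "e \<in> ?R"
  proof (rule ccontr)
    assume "e \<notin> ?R"
    then have conn: "reach (E - {e}) a b" if "a \<in> A" "b \<in> A" for a b using eE that by auto
    \<comment> \<open>For empty \<open>A\<close> any vertex will do as the start of the component.\<close>
    obtain a where a: "a \<in> V" "A \<noteq> {} \<Longrightarrow> a \<in> A" using V(2) A by blast
    define U where "U = {v \<in> V. reach (E - {e}) a v}"
    define F where "F = {d \<in> E - {e}. d \<subseteq> U}"
    have aU: "a \<in> U" using a by (auto simp: U_def)
    have "A \<subseteq> U" using a conn A by (auto simp: U_def)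
    have reachF: "reach F a v" if "reach (E - {e}) a v" for v
      using that
    proof (induction rule: rtrancl_induct)
      case base
      then show ?case by auto
    next
      case (step y z)
      have "y \<in> V" "z \<in> V" using step(2) finite_tree_edges[OF T, of "{y, z}"]
        by (auto simp: doubleton_eq_iff)
      moreover have "reach (E - {e}) a z" using step(1,2) by (rule rtrancl_into_rtrancl)
      ultimately have "{y, z} \<in> F" using step(1,2) by (auto simp: F_def U_def)
      then show ?case by (intro rtrancl_trans[OF step.IH] reach_edge)
    qed
    have "finite_tree U F"
    proof (rule finite_treeI_reach)
      show "finite U" "U \<noteq> {}" using V aU by (auto simp: U_def)
      show "simple_graph U F" unfolding simple_graph_def
      proof
        fix d assume d: "d \<in> F"
        then obtain u v where "u \<noteq> v" "d = {u, v}"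
          using finite_tree_edges[OF T, of d] by (auto simp: F_def)
        then show "\<exists>u\<in>U. \<exists>v\<in>U. u \<noteq> v \<and> d = {u, v}" using d by (auto simp: F_def)
      qed
      have "U \<subseteq> V" "F \<subseteq> E" by (auto simp: U_def F_def)
      then show "\<nexists>p. cycle U F p" using cycle_mono V(4) by blast
      show "reach F u v" if "u \<in> U" "v \<in> U" for u v
        using that reachF[of u] reachF[of v] reach_sym[of a u F] rtrancl_trans[of u a _ v]
        by (simp add: U_def)
    qed
    then have "subtree U F V E" by (auto simp: subtree_def U_def F_def)
    then have "e \<in> F" using e \<open>A \<subseteq> U\<close> by (auto simp: span_edges_def)
    then show False by (auto simp: F_def)
  qed
qed

text \<open>
  Competitors in the Steiner problem have natural numbers as vertices, so the tree of a solution
  has to be copied before it can compete with a new weighting.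
\<close>

lemma finite_tree_image:
  assumes T: "finite_tree V E" and h: "inj_on h V"
  shows "finite_tree (h ` V) ((`) h ` E)"
proof (rule finite_treeI_reach)
  let ?g = "the_inv_into V h"
  have g: "?g (h v) = v" if "v \<in> V" for v using the_inv_into_f_f[OF h that] .
  have gE: "{?g x, ?g y} \<in> E" if xy: "{x, y} \<in> (`) h ` E" for x y
  proof -
    obtain d where d: "d \<in> E" "{x, y} = h ` d" using xy by (rule imageE)
    then obtain u v where "u \<in> V" "v \<in> V" "d = {u, v}" using finite_tree_edges[OF T] by blast
    moreover from this have "?g ` {x, y} = {u, v}" unfolding d(2) using g by auto
    ultimately show ?thesis using d(1) by simp
  qed
  have V: "finite V" "V \<noteq> {}" "\<nexists>p. cycle V E p"
    using T by (auto simp: finite_tree_def connected_graph_def)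
  then show "finite (h ` V)" "h ` V \<noteq> {}" by auto
  show "simple_graph (h ` V) ((`) h ` E)" unfolding simple_graph_def
  proof
    fix e assume "e \<in> (`) h ` E"
    then obtain d where d: "d \<in> E" "e = h ` d" by auto
    then obtain u v where uv: "u \<in> V" "v \<in> V" "u \<noteq> v" "d = {u, v}"
      using finite_tree_edges[OF T] by blast
    then have "h u \<noteq> h v" "e = {h u, h v}" using h d(2) by (auto dest: inj_onD)
    then show "\<exists>x\<in>h ` V. \<exists>y\<in>h ` V. x \<noteq> y \<and> e = {x, y}"
      using uv by blast
  qed
  show "\<nexists>p. cycle (h ` V) ((`) h ` E) p"
  proof
    assume "\<exists>p. cycle (h ` V) ((`) h ` E) p"
    then obtain p where p: "cycle (h ` V) ((`) h ` E) p" by blast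
    then have pV: "p \<noteq> []" "set p \<subseteq> h ` V" by (auto simp: cycle_def walk_def)
    then have "inj_on ?g (set p)" using h
      by (meson inj_on_subset inj_on_the_inv_into)
    moreover have "set (map ?g p) \<subseteq> V" using pV g by auto
    moreover have "{?g (p ! i), ?g (p ! Suc i)} \<in> E" if "Suc i < length p" for i
      using gE p that by (auto simp: cycle_def walk_def)
    moreover have "{?g (last p), ?g (hd p)} \<in> E" using gE p by (auto simp: cycle_def)
    ultimately have "cycle V E (map ?g p)" using p pV
      by (simp add: cycle_def walk_def distinct_map last_map hd_map)
    then show False using V by blast
  qed
  show "reach ((`) h ` E) x y" if xy: "x \<in> h ` V" "y \<in> h ` V" for x y
  proof -
    obtain u v where uv: "u \<in> V" "v \<in> V" "x = h u" "y = h v" using xy by auto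
    have "reach E u v" using finite_tree_reach[OF T] uv by blast
    then have "reach ((`) h ` E) (h u) (h v)"
    proof (induction rule: rtrancl_induct)
      case (step y z)
      then have "h ` {y, z} \<in> (`) h ` E" by blast
      then have "reach ((`) h ` E) (h y) (h z)" by (intro reach_edge) simp
      then show ?case using step.IH by (rule rtrancl_trans[rotated])
    qed auto
    then show ?thesis using uv by simp
  qed
qed


section \<open>Semidiversities\<close>

text \<open>
  A tree with edges of weight zero induces a function that vanishes on some sets with several points and
  so is not a diversity. What remains of the axioms is the following.
\<close>

definition semidiversity :: "'v set \<Rightarrow> ('v set \<Rightarrow> real) \<Rightarrow> bool" where
  "semidiversity V d \<longleftrightarrow> (\<forall>v\<in>V. d {v} = 0) \<and>
     (\<forall>A B C. A \<subseteq> V \<longrightarrow> B \<subseteq> V \<longrightarrow> C \<subseteq> V \<longrightarrow> B \<noteq> {} \<longrightarrow> d (A \<union> C) \<le> d (A \<union> B) + d (B \<union> C))"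

lemma semidiversity_triangle:
  "semidiversity V d \<Longrightarrow> A \<subseteq> V \<Longrightarrow> B \<subseteq> V \<Longrightarrow> C \<subseteq> V \<Longrightarrow> B \<noteq> {} \<Longrightarrow>
    d (A \<union> C) \<le> d (A \<union> B) + d (B \<union> C)"
  unfolding semidiversity_def by blast

lemma semidiversity_mono:
  assumes d: "semidiversity V d" and "finite B" "A \<subseteq> B" "B \<subseteq> V"
  shows "d A \<le> d B"
proof -
  have "d A \<le> d (A \<union> C)" if "finite C" "C \<subseteq> V" for C
    using that
  proof (induction C)
    case (insert b C)
    have "d ((A \<union> C) \<union> {}) \<le> d ((A \<union> C) \<union> {b}) + d ({b} \<union> {})"
      using insert.prems assms by (intro semidiversity_triangle[OF d]) auto
    moreover have "d {b} = 0" using d insert.prems by (auto simp: semidiversity_def)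
    ultimately show ?case using insert by simp
  qed simp
  from this[of B] show ?thesis using assms by (simp add: Un_absorb1)
qed

text \<open>Each set of \<open>S\<close> is glued to \<open>T\<close> at a point of \<open>T\<close>, by one triangle inequality.\<close>

lemma semidiversity_attach:
  assumes d: "semidiversity V d" and "finite S" "T \<subseteq> V"
    and "\<And>v A. (v, A) \<in> S \<Longrightarrow> v \<in> T \<and> A \<subseteq> V"
  shows "d (T \<union> \<Union>(snd ` S)) \<le> d T + (\<Sum>(v, A)\<in>S. d (A \<union> {v}))"
  using assms(2,4)
proof (induction S)
  case (insert vA S)
  obtain v A where vA: "vA = (v, A)" by fastforce
  let ?Z = "T \<union> \<Union>(snd ` S)"
  have v: "v \<in> T" "A \<subseteq> V" using insert.prems vA by auto
  have Z: "?Z \<subseteq> V" using insert.prems assms(3) by fastforce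
  have "d (?Z \<union> A) \<le> d (?Z \<union> {v}) + d ({v} \<union> A)"
    using v Z by (intro semidiversity_triangle[OF d]) auto
  moreover have "?Z \<union> {v} = ?Z" using v by auto
  moreover have "T \<union> \<Union>(snd ` insert vA S) = ?Z \<union> A" using vA by auto
  moreover have "d ?Z \<le> d T + (\<Sum>(v, A)\<in>S. d (A \<union> {v}))" using insert by auto
  ultimately show ?case using insert.hyps vA by (simp add: Un_commute)
qed simp

lemma (in diversity) semidiversity:
  assumes "finite X" shows "semidiversity X \<delta>"
  unfolding semidiversity_def
proof (intro conjI ballI allI impI)
  show "\<delta> {v} = 0" if "v \<in> X" for v using that zero_iff[of "{v}"] by (auto simp: Fpow_def)
  show "\<delta> (A \<union> C) \<le> \<delta> (A \<union> B) + \<delta> (B \<union> C)"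
    if "A \<subseteq> X" "B \<subseteq> X" "C \<subseteq> X" "B \<noteq> {}" for A B C
    using that assms by (intro triangle) (auto simp: Fpow_def intro: finite_subset)
qed

lemma semidiversity_tree_div:
  assumes T: "finite_tree V E" and w: "\<forall>e\<in>E. 0 \<le> w e"
  shows "semidiversity V (tree_div V E w)"
  unfolding semidiversity_def
proof (intro conjI ballI allI impI)
  have fin: "finite (span_edges V E A)" if "A \<subseteq> V" for A
    using span_edges_eq_separating[OF T that] finite_tree_finite_edges[OF T] by simp
  have pos: "0 \<le> w e" if "e \<in> span_edges V E A" "A \<subseteq> V" for e A
    using that span_edges_eq_separating[OF T] w by auto
  show "tree_div V E w {v} = 0" if "v \<in> V" for v
    using span_edges_eq_separating[OF T, of "{v}"] that by (simp add: tree_div_def)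
  fix A B C assume *: "A \<subseteq> V" "B \<subseteq> V" "C \<subseteq> V" "B \<noteq> {}"
  let ?s = "span_edges V E"
  obtain b where b: "b \<in> B" using * by auto
  \<comment> \<open>An edge that separates \<open>x\<close> from \<open>y\<close> separates \<open>b\<close> from one of them.\<close>
  have "?s (A \<union> C) \<subseteq> ?s (A \<union> B) \<union> ?s (B \<union> C)"
  proof
    fix e assume "e \<in> ?s (A \<union> C)"
    then obtain x y where e: "e \<in> E" "x \<in> A \<union> C" "y \<in> A \<union> C" "\<not> reach (E - {e}) x y"
      using span_edges_eq_separating[OF T, of "A \<union> C"] * by auto
    have spanI: "e \<in> ?s Z" if "\<not> reach (E - {e}) a c" "a \<in> Z" "c \<in> Z" "Z \<subseteq> V" for a c Z
      using that e(1) span_edges_eq_separating[OF T \<open>Z \<subseteq> V\<close>] by blast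
    have sub: "A \<union> B \<subseteq> V" "B \<union> C \<subseteq> V" using * by auto
    obtain z where "z \<in> A \<union> C" "\<not> reach (E - {e}) z b"
      using e rtrancl_trans[of x b _ y] reach_sym[of y b] by blast
    then show "e \<in> ?s (A \<union> B) \<union> ?s (B \<union> C)"
      using spanI[of z b "A \<union> B"] spanI[of z b "B \<union> C"] b sub by blast
  qed
  then have "sum w (?s (A \<union> C)) \<le> sum w (?s (A \<union> B) \<union> ?s (B \<union> C))"
    using fin pos * by (intro sum_mono2) auto
  also have "\<dots> \<le> sum w (?s (A \<union> B)) + sum w (?s (B \<union> C))"
  proof -
    have "0 \<le> sum w (?s (A \<union> B) \<inter> ?s (B \<union> C))"
      using pos[of _ "A \<union> B"] * by (intro sum_nonneg) auto
    then show ?thesis using sum_Un[of "?s (A \<union> B)" "?s (B \<union> C)" w] fin * by simp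
  qed
  finally show "tree_div V E w (A \<union> C) \<le> tree_div V E w (A \<union> B) + tree_div V E w (B \<union> C)"
    by (simp add: tree_div_def)
qed

lemma tree_div_edge_le:
  assumes T: "finite_tree V E" and w: "\<forall>e\<in>E. 0 \<le> w e" and e: "{u, v} \<in> E"
  shows "tree_div V E w {u, v} \<le> w {u, v}"
proof -
  have uv: "{u, v} \<subseteq> V" using finite_tree_edges[OF T e] by (auto simp: doubleton_eq_iff)
  have "span_edges V E {u, v} \<subseteq> {{u, v}}"
  proof
    fix d assume d: "d \<in> span_edges V E {u, v}"
    show "d \<in> {{u, v}}"
    proof (rule ccontr)
      assume "d \<notin> {{u, v}}"
      then have "reach (E - {d}) u v" using e by (intro reach_edge) auto
      then show False using d span_edges_eq_separating[OF T uv] reach_sym[of u v "E - {d}"] by auto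
    qed
  qed
  then have "tree_div V E w {u, v} \<le> sum w {{u, v}}"
    unfolding tree_div_def using w e by (intro sum_mono2) auto
  then show ?thesis by simp
qed


section \<open>Tight functions on a finite diversity\<close>

text \<open>
  A certificate of minimality that is easier to handle than the comparison with all competitors in
  \<open>div_P X \<delta>\<close>: every value of \<open>f\<close> occurs in an equality, so none can be lowered.
\<close>

definition tight :: "'a set \<Rightarrow> ('a set \<Rightarrow> real) \<Rightarrow> ('a set \<Rightarrow> real) \<Rightarrow> bool" where
  "tight X \<delta> f \<longleftrightarrow> f {} = 0 \<and> (\<forall>\<A>\<subseteq>Pow X. \<delta> (\<Union>\<A>) \<le> sum f \<A>) \<and>
     (\<forall>A\<subseteq>X. \<exists>\<A>\<subseteq>Pow X. A \<in> \<A> \<and> sum f \<A> = \<delta> (\<Union>\<A>))"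

lemma tight_covers: "tight X \<delta> f \<Longrightarrow> \<A> \<subseteq> Pow X \<Longrightarrow> \<delta> (\<Union>\<A>) \<le> sum f \<A>"
  by (simp add: tight_def)

lemma tight_attained:
  assumes "tight X \<delta> f" "A \<subseteq> X"
  obtains \<A> where "\<A> \<subseteq> Pow X" "A \<in> \<A>" "sum f \<A> = \<delta> (\<Union>\<A>)"
  using assms by (auto simp: tight_def)

lemma Fpow_eq_Pow: "finite X \<Longrightarrow> Fpow X = Pow X"
  by (auto simp: Fpow_def intro: finite_subset)

lemma tight_imp_tight_span:
  assumes X: "finite X" and f: "tight X \<delta> f" and ext: "f \<in> extensional (Pow X)"
  shows "f \<in> tight_span X \<delta>"
proof -
  have "f \<in> div_P X \<delta>"
    using f ext X by (simp add: tight_def div_P_def Fpow_eq_Pow)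
  moreover have "g = f" if g: "g \<in> div_P X \<delta>" "div_le X g f" for g
  proof (rule extensionalityI)
    show "g \<in> extensional (Pow X)" using g X by (simp add: div_P_def Fpow_eq_Pow)
    fix A assume "A \<in> Pow X"
    then have "A \<subseteq> X" by simp
    with f obtain \<A> where \<A>: "\<A> \<subseteq> Pow X" "A \<in> \<A>" "sum f \<A> = \<delta> (\<Union>\<A>)"
      by (rule tight_attained)
    have "finite \<A>" using \<A>(1) X finite_subset by blast
    have le: "\<And>B. B \<in> \<A> \<Longrightarrow> g B \<le> f B"
      using g(2) X \<A>(1) by (auto simp: div_le_def Fpow_eq_Pow)
    have "\<delta> (\<Union>\<A>) \<le> sum g \<A>" using g(1) X \<A>(1) by (simp add: div_P_def Fpow_eq_Pow)
    then have "sum g \<A> = sum f \<A>" using sum_mono[of \<A> g f, OF le] \<A>(3) by linarith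
    then show "g A = f A" using sum_mono_inv[of g \<A> f A] le \<A>(2) \<open>finite \<A>\<close> by blast
  qed (fact ext)
  ultimately show ?thesis by (auto simp: tight_span_def)
qed

lemma tight_ge:
  assumes "tight X \<delta> f" "A \<subseteq> X" shows "\<delta> A \<le> f A"
proof -
  have "\<delta> (\<Union>{A}) \<le> sum f {A}" using assms by (intro tight_covers) auto
  then show ?thesis by simp
qed

lemma (in diversity) tight_nonneg:
  assumes "finite X" "tight X \<delta> f" "A \<subseteq> X" shows "0 \<le> f A"
  using tight_ge[OF assms(2,3)] nonneg[of A] assms by (simp add: Fpow_eq_Pow)

text \<open>In the equality that contains \<open>A \<union> B\<close>, replace this set by \<open>A\<close> and \<open>B\<close>, which cover the same points.\<close>

lemma (in diversity) tight_subadditive: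
  assumes X: "finite X" and f: "tight X \<delta> f" and AB: "A \<subseteq> X" "B \<subseteq> X"
  shows "f (A \<union> B) \<le> f A + f B"
proof -
  obtain \<A> where \<A>: "\<A> \<subseteq> Pow X" "A \<union> B \<in> \<A>" "sum f \<A> = \<delta> (\<Union>\<A>)"
    using tight_attained[OF f Un_least[OF AB]] .
  let ?\<B> = "\<A> - {A \<union> B}"
  have fin: "finite \<A>" using \<A>(1) X finite_subset by blast
  have sub: "?\<B> \<union> {A, B} \<subseteq> Pow X" using \<A>(1) AB by auto
  have pos: "\<And>C. C \<in> ?\<B> \<union> {A, B} \<Longrightarrow> 0 \<le> f C" using tight_nonneg[OF X f] sub by blast
  have "\<Union>(?\<B> \<union> {A, B}) = \<Union>\<A>" using \<A>(2) by auto
  then have "\<delta> (\<Union>\<A>) \<le> sum f (?\<B> \<union> {A, B})" using tight_covers[OF f sub] by simp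
  also have "\<dots> \<le> sum f ?\<B> + sum f {A, B}"
    using sum_Un[of ?\<B> "{A, B}" f] fin sum_nonneg[of "?\<B> \<inter> {A, B}" f] pos by simp
  also have "sum f {A, B} \<le> f A + f B" using pos[of A] by (cases "A = B") auto
  finally show ?thesis using \<A>(2,3) fin by (simp add: sum.remove[of \<A> "A \<union> B" f])
qed

lemma tight_span_div_pair:
  assumes "finite X"
  shows "tight_span_div X \<delta> {f, g} =
    (SUP \<A>\<in>Pow (Pow X). \<delta> (\<Union>\<A>) - (\<Sum>A\<in>\<A>. min (f A) (g A)))"
  using assms by (simp add: tight_span_div_def Fpow_eq_Pow cInf_eq_Min)

lemma tight_span_div_pair_le:
  assumes "finite X"
    and "\<And>\<A>. \<A> \<subseteq> Pow X \<Longrightarrow> \<delta> (\<Union>\<A>) \<le> (\<Sum>A\<in>\<A>. min (f A) (g A)) + c"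
  shows "tight_span_div X \<delta> {f, g} \<le> c"
  unfolding tight_span_div_pair[OF assms(1)]
proof (rule cSUP_least)
  show "\<delta> (\<Union>\<A>) - (\<Sum>A\<in>\<A>. min (f A) (g A)) \<le> c" if "\<A> \<in> Pow (Pow X)" for \<A>
    using assms(2)[of \<A>] that by simp
qed auto

text \<open>
  The family in which \<open>f A\<close> is tight competes in the supremum. Its value there is the sum of
  the gaps between \<open>f\<close> and \<open>min f g\<close>, one of which is the gap at \<open>A\<close>.
\<close>

lemma tight_diff_le_tight_span_div:
  assumes X: "finite X" and f: "tight X \<delta> f" and A: "A \<subseteq> X"
  shows "f A - g A \<le> tight_span_div X \<delta> {f, g}"
proof -
  obtain \<A> where \<A>: "\<A> \<subseteq> Pow X" "A \<in> \<A>" "sum f \<A> = \<delta> (\<Union>\<A>)"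
    using tight_attained[OF f A] .
  have "finite \<A>" using \<A>(1) X finite_subset by blast
  have "f A - g A \<le> f A - min (f A) (g A)" by simp
  also have "\<dots> \<le> (\<Sum>B\<in>\<A>. f B - min (f B) (g B))"
    using \<A>(2) \<open>finite \<A>\<close> by (intro member_le_sum) auto
  also have "\<dots> = \<delta> (\<Union>\<A>) - (\<Sum>B\<in>\<A>. min (f B) (g B))"
    using \<A>(3) by (simp add: sum_subtractf)
  also have "\<dots> \<le> tight_span_div X \<delta> {f, g}"
    unfolding tight_span_div_pair[OF X] using \<A>(1) X
    by (intro cSUP_upper) (auto intro!: bdd_above_finite)
  finally show ?thesis .
qed


section \<open>Extending the canonical embedding\<close>

text \<open>The tree enters the extension problem only through the semidiversity \<open>D\<close> on its vertices.\<close>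

locale dominating_semidiversity = diversity X \<delta>
  for X :: "'a set" and \<delta> :: "'a set \<Rightarrow> real" +
  fixes V :: "'a set" and D :: "'a set \<Rightarrow> real"
  assumes finite_V: "finite V" and X_sub: "X \<subseteq> V"
    and semidiversity_D: "semidiversity V D"
    and dominates: "Y \<subseteq> X \<Longrightarrow> \<delta> Y \<le> D Y"
begin

lemma finite_X: "finite X"
  using finite_V X_sub finite_subset by blast

text \<open>
  On \<open>X\<close> this is the canonical embedding of \<open>X\<close>. Elsewhere it is the canonical map of \<open>(V, D)\<close>,
  restricted to subsets of \<open>X\<close>.
\<close>

definition initial :: "'a \<times> 'a set \<Rightarrow> real" where
  "initial = (\<lambda>(v, A). if v \<in> X then \<delta> (A \<union> {v}) else D (A \<union> {v}))"

text \<open>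
  The sets attached at vertices outside \<open>X\<close> are glued to \<open>fst ` S\<close> within \<open>D\<close>. Passing from \<open>D\<close> to the
  smaller \<open>\<delta>\<close> on the points of \<open>X\<close> reached so far, the sets attached at points of \<open>X\<close> are glued within \<open>\<delta>\<close>.
\<close>

lemma initial_covers:
  assumes S: "S \<subseteq> V \<times> Pow X"
  shows "\<delta> (\<Union>(snd ` S)) \<le> sum initial S + D (fst ` S)"
proof -
  define S1 where "S1 = {i \<in> S. fst i \<in> X}"
  define S2 where "S2 = {i \<in> S. fst i \<notin> X}"
  have "finite (V \<times> Pow X)" using finite_V finite_X by simp
  then have "finite S" using S finite_subset by blast
  then have fin: "finite S1" "finite S2" by (auto simp: S1_def S2_def)
  have S12: "S = S1 \<union> S2" "S1 \<inter> S2 = {}" by (auto simp: S1_def S2_def)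
  let ?Z = "fst ` S \<union> \<Union>(snd ` S2)"
  have Z: "?Z \<subseteq> V" using S X_sub by (fastforce simp: S2_def)
  have "\<delta> (\<Union>(snd ` S)) \<le> \<delta> (?Z \<inter> X \<union> \<Union>(snd ` S1))"
  proof (rule semidiversity_mono[OF semidiversity[OF finite_X]])
    show "\<Union>(snd ` S) \<subseteq> ?Z \<inter> X \<union> \<Union>(snd ` S1)" using S by (fastforce simp: S12(1))
    show "?Z \<inter> X \<union> \<Union>(snd ` S1) \<subseteq> X" using S by (fastforce simp: S1_def)
    then show "finite (?Z \<inter> X \<union> \<Union>(snd ` S1))" using finite_X finite_subset by blast
  qed
  also have "\<dots> \<le> \<delta> (?Z \<inter> X) + (\<Sum>(v, A)\<in>S1. \<delta> (A \<union> {v}))"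
    using S by (intro semidiversity_attach[OF semidiversity[OF finite_X] fin(1)])
      (auto simp: S1_def rev_image_eqI)
  also have "\<delta> (?Z \<inter> X) \<le> D (?Z \<inter> X)" by (intro dominates) auto
  also have "D (?Z \<inter> X) \<le> D ?Z"
    using Z finite_V finite_subset by (intro semidiversity_mono[OF semidiversity_D]) blast+
  also have "D ?Z \<le> D (fst ` S) + (\<Sum>(v, A)\<in>S2. D (A \<union> {v}))"
    using S X_sub by (intro semidiversity_attach[OF semidiversity_D fin(2)])
      (auto simp: S2_def rev_image_eqI)
  also have "(\<Sum>(v, A)\<in>S1. \<delta> (A \<union> {v})) = sum initial S1"
    by (intro sum.cong) (auto simp: initial_def S1_def)
  also have "(\<Sum>(v, A)\<in>S2. D (A \<union> {v})) = sum initial S2"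
    by (intro sum.cong) (auto simp: initial_def S2_def)
  finally show ?thesis using S12 fin by (simp add: sum.union_disjoint)
qed

text \<open>
  Tightness within the system of constraints for all vertices together is turned into tightness
  at a single vertex. The key is the inequality \<open>exchange\<close>: the value at \<open>u\<close> of a union is bounded by the
  values of its parts at other vertices and the cost in \<open>D\<close> of joining these vertices to \<open>u\<close>. In an
  equality that contains \<open>(u, A)\<close>, the entries at other vertices can therefore be replaced by a single
  entry at \<open>u\<close>.
\<close>

lemma exists_tight_family:
  obtains F where "\<And>v. v \<in> V \<Longrightarrow> tight X \<delta> (F v)"
    "\<And>v A. F v A \<le> initial (v, A)"
    "\<And>S. S \<subseteq> V \<times> Pow X \<Longrightarrow> \<delta> (\<Union>(snd ` S)) \<le> (\<Sum>(v, A)\<in>S. F v A) + D (fst ` S)"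
proof -
  let ?I = "V \<times> Pow X"
  have fin_I: "finite ?I" using finite_V finite_X by simp
  define c where "c = (\<lambda>S. \<delta> (\<Union>(snd ` S)) - D (fst ` S))"
  have "\<forall>S\<subseteq>?I. c S \<le> sum initial S"
    using initial_covers by (simp add: c_def le_diff_eq diff_le_eq)
  from lower_to_tight[OF fin_I this]
  obtain G where G: "\<forall>i. G i \<le> initial i" "\<forall>S\<subseteq>?I. c S \<le> sum G S"
    "\<forall>i\<in>?I. \<exists>S\<subseteq>?I. i \<in> S \<and> sum G S = c S"
    by (elim exE conjE)
  have covers: "\<delta> (\<Union>(snd ` S)) \<le> sum G S + D (fst ` S)" if "S \<subseteq> ?I" for S
    using spec[OF G(2), of S] that by (simp add: c_def)
  have D_single: "D {v} = 0" if "v \<in> V" for v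
    using semidiversity_D that by (auto simp: semidiversity_def)
  have fin: "finite S" if "S \<subseteq> ?I" for S using that fin_I finite_subset by blast
  have pos: "0 \<le> G i" if i: "i \<in> ?I" for i
  proof -
    obtain v A where "i = (v, A)" "v \<in> V" "A \<subseteq> X" using i by auto
    then show ?thesis using covers[of "{i}"] D_single nonneg[of A] finite_X
      by (simp add: Fpow_eq_Pow)
  qed
  have sum_Un_le: "sum G (S \<union> S') \<le> sum G S + sum G S'" if "S \<subseteq> ?I" "S' \<subseteq> ?I" for S S'
  proof -
    have "0 \<le> sum G (S \<inter> S')" using that pos by (intro sum_nonneg) blast
    then show ?thesis using sum_Un[of S S' G] fin that by simp
  qed
  have exchange: "G (u, \<Union>(snd ` S)) \<le> sum G S + D (insert u (fst ` S))"
    if u: "u \<in> V" and S: "S \<subseteq> ?I" for u S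
  proof -
    let ?i = "(u, \<Union>(snd ` S))"
    have "\<Union>(snd ` S) \<subseteq> X" using S by fastforce
    then have "?i \<in> ?I" using u by simp
    \<comment> \<open>The union is tight in the constraint \<open>R\<close>; replacing it there by its parts from \<open>S\<close> gives another constraint.\<close>
    then obtain R where R: "R \<subseteq> ?I" "?i \<in> R" "sum G R = c R"
      using bspec[OF G(3), of ?i] by auto
    let ?R = "R - {?i}"
    have RS: "?R \<union> S \<subseteq> ?I" using R S by auto
    have fst_sub: "fst ` ?R \<subseteq> V" "fst ` S \<subseteq> V" "insert u (fst ` S) \<subseteq> V" using R S u by auto
    have "R = insert ?i ?R" using R(2) by blast
    then have "snd ` R = insert (\<Union>(snd ` S)) (snd ` ?R)" using image_insert[of snd ?i ?R] by simp
    then have "\<Union>(snd ` R) = \<Union>(snd ` (?R \<union> S))" by (simp add: image_Un Un_commute)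
    then have "\<delta> (\<Union>(snd ` R)) \<le> sum G (?R \<union> S) + D (fst ` ?R \<union> fst ` S)"
      using covers[OF RS] by (simp add: image_Un)
    also have "sum G (?R \<union> S) \<le> sum G ?R + sum G S" using R S by (intro sum_Un_le) auto
    also have "D (fst ` ?R \<union> fst ` S) \<le> D (fst ` ?R \<union> {u}) + D ({u} \<union> fst ` S)"
      using fst_sub u by (intro semidiversity_triangle[OF semidiversity_D]) auto
    also have "fst ` ?R \<union> {u} = fst ` R"
      using \<open>R = insert ?i ?R\<close> image_insert[of fst ?i ?R] by simp
    finally have "\<delta> (\<Union>(snd ` R)) \<le> sum G ?R + sum G S + (D (fst ` R) + D (insert u (fst ` S)))"
      by simp
    moreover have "sum G R = G ?i + sum G ?R" using R fin by (intro sum.remove) auto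
    ultimately show ?thesis using R(3) by (simp add: c_def)
  qed
  have lift: "sum G ({u} \<times> \<A>) = (\<Sum>A\<in>\<A>. G (u, A))" for u \<A>
  proof -
    have "{u} \<times> \<A> = Pair u ` \<A>" by auto
    then show ?thesis by (simp add: sum.reindex inj_on_def)
  qed
  have snd_lift: "\<Union>(snd ` ({u} \<times> \<A>)) = \<Union>\<A>" for u :: 'a and \<A> :: "'a set set" by force
  have covers_at: "\<delta> (\<Union>\<A>) \<le> (\<Sum>A\<in>\<A>. G (u, A))" if "u \<in> V" "\<A> \<subseteq> Pow X" for u \<A>
  proof (cases "\<A> = {}")
    case True
    then show ?thesis using zero_iff[of "{}"] by (simp add: Fpow_def)
  next
    case False
    then have "fst ` ({u} \<times> \<A>) = {u}" by force
    moreover have "{u} \<times> \<A> \<subseteq> ?I" using that by auto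
    ultimately show ?thesis using covers[of "{u} \<times> \<A>"] D_single[of u] that
      by (simp add: snd_lift lift)
  qed
  have "tight X \<delta> (\<lambda>A. G (u, A))" if u: "u \<in> V" for u
    unfolding tight_def
  proof (intro conjI allI impI)
    have "initial (u, {}) = 0"
      using D_single[OF u] zero_iff[of "{u}"] by (simp add: initial_def Fpow_def)
    then show "G (u, {}) = 0" using spec[OF G(1), of "(u, {})"] pos[of "(u, {})"] u by simp
    show "\<delta> (\<Union>\<A>) \<le> (\<Sum>A\<in>\<A>. G (u, A))" if "\<A> \<subseteq> Pow X" for \<A>
      using covers_at[OF u that] .
    fix A assume A: "A \<subseteq> X"
    then obtain S where S: "S \<subseteq> ?I" "(u, A) \<in> S" "sum G S = c S"
      using bspec[OF G(3), of "(u, A)"] u by auto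
    define \<B> where "\<B> = {B. (u, B) \<in> S}"
    define S' where "S' = S - {u} \<times> \<B>"
    \<comment> \<open>The entries \<open>S'\<close> of the equality at vertices other than \<open>u\<close> are merged into \<open>B'\<close>.\<close>
    define B' where "B' = \<Union>(snd ` S')"
    have \<B>: "\<B> \<subseteq> Pow X" "A \<in> \<B>" using S(1,2) by (auto simp: \<B>_def)
    have S_eq: "S = {u} \<times> \<B> \<union> S'" by (auto simp: S'_def \<B>_def)
    have "fst ` ({u} \<times> \<B>) = {u}" using \<B>(2) by (auto simp: image_iff)
    then have S': "S' \<subseteq> ?I" "insert u (fst ` S') = fst ` S"
      using S(1) by (auto simp: S'_def) (simp add: S_eq image_Un)
    have B': "B' \<subseteq> X" using S'(1) by (fastforce simp: B'_def)
    have fin\<B>: "finite \<B>" using \<B>(1) finite_X finite_subset by blast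
    have "sum G S = sum G ({u} \<times> \<B>) + sum G S'"
      unfolding S_eq using fin[OF S(1)] fin\<B>
      by (intro sum.union_disjoint) (auto simp: S'_def)
    moreover have "G (u, B') \<le> sum G S' + D (fst ` S)"
      using exchange[OF u S'(1)] S'(2) by (simp add: B'_def)
    moreover have "\<Union>(snd ` S) = \<Union>(insert B' \<B>)"
      unfolding S_eq by (auto simp: B'_def image_Un)
    moreover have "(\<Sum>B\<in>insert B' \<B>. G (u, B)) \<le> G (u, B') + (\<Sum>B\<in>\<B>. G (u, B))"
      using fin\<B> pos[of "(u, B')"] B' u by (cases "B' \<in> \<B>") (auto simp: insert_absorb)
    ultimately have "(\<Sum>B\<in>insert B' \<B>. G (u, B)) \<le> \<delta> (\<Union>(insert B' \<B>))"
      using S(3) by (simp add: c_def lift)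
    moreover have "\<delta> (\<Union>(insert B' \<B>)) \<le> (\<Sum>B\<in>insert B' \<B>. G (u, B))"
      using \<B> B' by (intro covers_at[OF u]) auto
    ultimately show "\<exists>\<A>\<subseteq>Pow X. A \<in> \<A> \<and> (\<Sum>A\<in>\<A>. G (u, A)) = \<delta> (\<Union>\<A>)"
      using \<B> B' by (intro exI[of _ "insert B' \<B>"]) auto
  qed
  moreover have "(\<Sum>(v, A)\<in>S. G (v, A)) = sum G S" for S by (intro sum.cong) auto
  ultimately show ?thesis using G(1) covers by (intro that[of "\<lambda>v A. G (v, A)"]) auto
qed

text \<open>
  At \<open>x \<in> X\<close> the family lies below \<open>kappa X \<delta> x\<close> by construction, and above it because its value on
  \<open>{x}\<close> is zero and it is subadditive. A competitor in the supremum for \<open>\<phi> u\<close> and \<open>\<phi> v\<close> is a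
  family of sets, each of which is assigned to the vertex with the smaller value. This gives a
  constraint whose vertices are among \<open>u\<close> and \<open>v\<close>.
\<close>

theorem exists_nonexpansive_extension:
  obtains \<phi> where "\<And>v. v \<in> V \<Longrightarrow> \<phi> v \<in> extensional (Pow X)"
    "\<And>v. v \<in> V \<Longrightarrow> tight X \<delta> (\<phi> v)"
    "\<And>x. x \<in> X \<Longrightarrow> \<phi> x = kappa X \<delta> x"
    "\<And>u v. u \<in> V \<Longrightarrow> v \<in> V \<Longrightarrow> tight_span_div X \<delta> {\<phi> u, \<phi> v} \<le> D {u, v}"
proof -
  obtain F where F: "\<And>v. v \<in> V \<Longrightarrow> tight X \<delta> (F v)"
    "\<And>v A. F v A \<le> initial (v, A)"
    "\<And>S. S \<subseteq> V \<times> Pow X \<Longrightarrow> \<delta> (\<Union>(snd ` S)) \<le> (\<Sum>(v, A)\<in>S. F v A) + D (fst ` S)"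
    using exists_tight_family by blast
  define \<phi> where "\<phi> = (\<lambda>v. restrict (F v) (Pow X))"
  have sum_\<phi>: "sum (\<phi> v) \<A> = sum (F v) \<A>" if "\<A> \<subseteq> Pow X" for v \<A>
    using that by (intro sum.cong) (auto simp: \<phi>_def)
  have tight: "tight X \<delta> (\<phi> v)" if "v \<in> V" for v
    unfolding tight_def
  proof (intro conjI allI impI)
    note Fv = F(1)[OF that, unfolded tight_def]
    show "\<phi> v {} = 0" using Fv by (simp add: \<phi>_def)
    show "\<delta> (\<Union>\<A>) \<le> sum (\<phi> v) \<A>" if "\<A> \<subseteq> Pow X" for \<A>
      using Fv that by (simp add: sum_\<phi>)
    fix A assume "A \<subseteq> X"
    with F(1)[OF that] obtain \<A> where "\<A> \<subseteq> Pow X" "A \<in> \<A>" "sum (F v) \<A> = \<delta> (\<Union>\<A>)"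
      by (rule tight_attained)
    then show "\<exists>\<A>\<subseteq>Pow X. A \<in> \<A> \<and> sum (\<phi> v) \<A> = \<delta> (\<Union>\<A>)"
      by (intro exI[of _ \<A>]) (simp add: sum_\<phi>)
  qed
  have kappa: "\<phi> x = kappa X \<delta> x" if x: "x \<in> X" for x
  proof
    fix A
    show "\<phi> x A = kappa X \<delta> x A"
    proof (cases "A \<subseteq> X")
      case True
      have xV: "x \<in> V" using x X_sub by auto
      have "F x (A \<union> {x}) \<le> F x A + F x {x}"
        using x True by (intro tight_subadditive[OF finite_X F(1)[OF xV]]) auto
      moreover have "\<delta> (A \<union> {x}) \<le> F x (A \<union> {x})" using x True by (intro tight_ge[OF F(1)[OF xV]]) auto
      moreover have "F x {x} \<le> 0"
        using F(2)[of x "{x}"] x zero_iff[of "{x}"] by (simp add: initial_def Fpow_def)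
      moreover have "F x A \<le> \<delta> (A \<union> {x})" using F(2)[of x A] x by (simp add: initial_def)
      ultimately show ?thesis using True by (simp add: \<phi>_def kappa_def Fpow_eq_Pow finite_X)
    qed (simp add: \<phi>_def kappa_def Fpow_eq_Pow finite_X)
  qed
  have "tight_span_div X \<delta> {\<phi> u, \<phi> v} \<le> D {u, v}" if uv: "u \<in> V" "v \<in> V" for u v
  proof (rule tight_span_div_pair_le[OF finite_X])
    fix \<A> assume \<A>: "\<A> \<subseteq> Pow X"
    define a where "a = (\<lambda>A. if F u A \<le> F v A then u else v)"
    define S where "S = (\<lambda>A. (a A, A)) ` \<A>"
    have S: "S \<subseteq> V \<times> Pow X" "\<Union>(snd ` S) = \<Union>\<A>" "fst ` S \<subseteq> {u, v}"
      using \<A> uv by (auto simp: S_def a_def)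
    have "(\<Sum>(v, A)\<in>S. F v A) = (\<Sum>A\<in>\<A>. F (a A) A)"
      unfolding S_def by (subst sum.reindex) (auto simp: inj_on_def)
    also have "\<dots> = (\<Sum>A\<in>\<A>. min (\<phi> u A) (\<phi> v A))"
      using \<A> by (intro sum.cong) (auto simp: a_def \<phi>_def)
    finally have "(\<Sum>(v, A)\<in>S. F v A) = \<dots>" .
    moreover have "D (fst ` S) \<le> D {u, v}"
      using S(3) uv by (intro semidiversity_mono[OF semidiversity_D]) auto
    ultimately show "\<delta> (\<Union>\<A>) \<le> (\<Sum>A\<in>\<A>. min (\<phi> u A) (\<phi> v A)) + D {u, v}"
      using F(3)[OF S(1)] S(2) by simp
  qed
  then show ?thesis using tight kappa by (intro that[of \<phi>]) (auto simp: \<phi>_def)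
qed

end


section \<open>Trees mapped into the tight span\<close>

text \<open>
  The vertex sets obtained from a root by adding one adjacent vertex at a time give an induction
  principle for finite trees.
\<close>

inductive grown :: "'v set set \<Rightarrow> 'v \<Rightarrow> 'v set \<Rightarrow> bool" for E r where
  root: "grown E r {r}"
| attach: "grown E r W \<Longrightarrow> p \<in> W \<Longrightarrow> q \<notin> W \<Longrightarrow> {p, q} \<in> E \<Longrightarrow> grown E r (insert q W)"

lemma grown_contains_root: "grown E r W \<Longrightarrow> r \<in> W"
  by (induction rule: grown.induct) auto

lemma grown_reach: "grown E r W \<Longrightarrow> v \<in> W \<Longrightarrow> reach {e \<in> E. e \<subseteq> W} r v"
proof (induction arbitrary: v rule: grown.induct)
  case (attach W p q)
  let ?F = "{e \<in> E. e \<subseteq> insert q W}"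
  have W: "reach ?F r v" if "v \<in> W" for v
    using reach_mono[OF attach.IH[OF that], of ?F] by auto
  have "reach ?F p q" using attach.hyps by (intro reach_edge) auto
  then have "reach ?F r q" using W[OF attach.hyps(2)] by (rule rtrancl_trans[rotated])
  then show ?case using W attach.prems by blast
qed simp

text \<open>A largest grown set has no edge that leaves it.\<close>

lemma grown_all:
  assumes T: "finite_tree V E" and r: "r \<in> V"
  shows "grown E r V"
proof -
  let ?P = "\<lambda>W. grown E r W \<and> W \<subseteq> V"
  have V: "finite V" using T by (simp add: finite_tree_def)
  have "?P {r}" using r by (auto intro: root)
  moreover have "\<forall>W. ?P W \<longrightarrow> card W < Suc (card V)"
    using V by (auto simp: less_Suc_eq_le intro: card_mono)
  ultimately have "\<exists>W. ?P W \<and> (\<forall>W'. ?P W' \<longrightarrow> card W' \<le> card W)"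
    by (rule ex_has_greatest_nat)
  then obtain W where *: "?P W \<and> (\<forall>W'. ?P W' \<longrightarrow> card W' \<le> card W)" by (rule exE)
  note W = conjunct1[OF *] and W_max = conjunct2[OF *]
  have "r \<in> W" using W grown_contains_root[of E r W] by simp
  have closed: "z \<in> W" if "y \<in> W" "{y, z} \<in> E" for y z
  proof (rule ccontr)
    assume z: "z \<notin> W"
    have "z \<in> V" using finite_tree_edges[OF T that(2)] by (auto simp: doubleton_eq_iff)
    then have "?P (insert z W)" using grown.attach[of E r W y z] W that z by auto
    then have "card (insert z W) \<le> card W" using spec[OF W_max, of "insert z W"] by simp
    moreover have "finite W" using W V finite_subset by blast
    ultimately show False using z by simp
  qed
  have "v \<in> W" if "v \<in> V" for v
    using finite_tree_reach[OF T r that]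
    by (induction rule: rtrancl_induct) (use \<open>r \<in> W\<close> closed in auto)
  then have "W = V" using W by blast
  then show ?thesis using W by simp
qed

text \<open>
  When a vertex \<open>q\<close> is attached to \<open>p\<close>, the set at \<open>q\<close> is moved to \<open>p\<close>. This costs the weight of the new
  edge, by the Lipschitz condition, and the two sets now at \<open>p\<close> are merged by subadditivity. An edge is charged only
  when a non-empty set crosses it on its way to the root, so only edges that separate the
  root from some non-empty set are charged.
\<close>

lemma (in diversity) tight_tree_bound:
  fixes f :: "'v \<Rightarrow> 'a set \<Rightarrow> real"
  assumes X: "finite X" and T: "finite_tree V E" and r: "r \<in> V"
    and f: "\<And>v. v \<in> V \<Longrightarrow> tight X \<delta> (f v)"
    and w: "\<And>e. e \<in> E \<Longrightarrow> 0 \<le> w e"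
    and lip: "\<And>u v A. {u, v} \<in> E \<Longrightarrow> A \<subseteq> X \<Longrightarrow> f u A \<le> f v A + w {u, v}"
    and B: "\<And>v. v \<in> V \<Longrightarrow> B v \<subseteq> X"
  shows "f r (\<Union>v\<in>V. B v) \<le>
    (\<Sum>v\<in>V. f v (B v)) + tree_div V E w (insert r {v \<in> V. B v \<noteq> {}})"
proof -
  \<comment> \<open>The edges that are charged while the sets \<open>B v\<close> with \<open>v \<in> W\<close> move to the root.\<close>
  define K where "K = (\<lambda>W B. {e \<in> E. \<exists>v\<in>W. B v \<noteq> ({} :: 'a set) \<and> \<not> reach (E - {e}) r v})"
  have finE: "finite E" using finite_tree_finite_edges[OF T] .
  have "f r (\<Union>v\<in>W. B v) \<le> (\<Sum>v\<in>W. f v (B v)) + sum w (K W B)"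
    if "grown E r W" "W \<subseteq> V" "\<And>v. v \<in> W \<Longrightarrow> B v \<subseteq> X" for W B
    using that
  proof (induction arbitrary: B rule: grown.induct)
    case root
    have "0 \<le> sum w (K {r} B)" using w by (intro sum_nonneg) (auto simp: K_def)
    then show ?case by simp
  next
    case (attach W p q)
    let ?e = "{p, q}"
    have finW: "finite W" using attach.prems T finite_subset by (auto simp: finite_tree_def)
    have pV: "p \<in> V" "q \<in> V" using attach by auto
    have finK: "finite (K U C)" for U C using finE by (simp add: K_def)
    have K_nonneg: "0 \<le> w e" if "e \<in> K U C" for e U C using w that by (simp add: K_def)
    show ?case
    proof (cases "B q = {}")
      case True
      have "f q {} = 0" using f[OF pV(2)] by (simp add: tight_def)
      moreover have "K (insert q W) B = K W B" using True by (auto simp: K_def)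
      moreover have "f r (\<Union>v\<in>W. B v) \<le> (\<Sum>v\<in>W. f v (B v)) + sum w (K W B)"
        using attach.prems by (intro attach.IH) auto
      ultimately show ?thesis using True finW attach.hyps(3) by simp
    next
      case False
      define C where "C = B(p := B p \<union> B q)"
      have reach_W: "reach (E - {?e}) r v" if "v \<in> W" for v
        using reach_mono[OF grown_reach[OF attach.hyps(1) that], of "E - {?e}"] attach.hyps(3)
        by auto
      have "\<not> reach (E - {?e}) r q"
        using tree_edge_separates[OF T attach.hyps(4)] reach_W[OF attach.hyps(2)]
          reach_sym[of r p] rtrancl_trans[of p r _ q] by blast
      then have eK: "?e \<in> K (insert q W) B" using attach.hyps(4) False by (auto simp: K_def)
      have "K W C \<subseteq> K (insert q W) B - {?e}"
      proof
        fix d assume "d \<in> K W C"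
        then obtain v where d: "d \<in> E" "v \<in> W" "C v \<noteq> {}" "\<not> reach (E - {d}) r v"
          by (auto simp: K_def)
        have "d \<noteq> ?e" using reach_W d by auto
        have "\<exists>v\<in>insert q W. B v \<noteq> {} \<and> \<not> reach (E - {d}) r v"
        proof (cases "v = p")
          case True
          have "reach (E - {d}) q p"
            using attach.hyps(4) \<open>d \<noteq> ?e\<close> by (intro reach_edge) (auto simp: insert_commute)
          then have "\<not> reach (E - {d}) r q"
            using d(4) True rtrancl_trans[of r q _ p] by blast
          then show ?thesis using False by auto
        next
          case False
          then show ?thesis using d by (auto simp: C_def)
        qed
        then show "d \<in> K (insert q W) B - {?e}" using d \<open>d \<noteq> ?e\<close> by (auto simp: K_def)
      qed
      then have "sum w (K W C) \<le> sum w (K (insert q W) B - {?e})"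
        by (intro sum_mono2) (auto simp: finK intro: K_nonneg)
      also have "\<dots> = sum w (K (insert q W) B) - w ?e"
        using eK finK by (simp add: sum_diff1)
      finally have wK: "sum w (K W C) + w ?e \<le> sum w (K (insert q W) B)" by simp
      have BX: "B p \<subseteq> X" "B q \<subseteq> X" using attach.prems(2) attach.hyps(2) by auto
      have "f p (B p \<union> B q) \<le> f p (B p) + f p (B q)"
        by (rule tight_subadditive[OF X f[OF pV(1)] BX])
      also have "f p (B q) \<le> f q (B q) + w ?e" using lip[OF attach.hyps(4) BX(2)] .
      finally have step: "f p (C p) \<le> f p (B p) + (f q (B q) + w ?e)" by (simp add: C_def)
      have "(\<Sum>v\<in>W. f v (C v)) = f p (C p) + (\<Sum>v\<in>W - {p}. f v (C v))"
        using finW attach.hyps(2) by (rule sum.remove)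
      also have "(\<Sum>v\<in>W - {p}. f v (C v)) = (\<Sum>v\<in>W - {p}. f v (B v))"
        by (intro sum.cong) (auto simp: C_def)
      also have "f p (C p) + \<dots> \<le> (f p (B p) + \<dots>) + f q (B q) + w ?e" using step by simp
      also have "f p (B p) + (\<Sum>v\<in>W - {p}. f v (B v)) = (\<Sum>v\<in>W. f v (B v))"
        using finW attach.hyps(2) by (simp add: sum.remove)
      finally have "(\<Sum>v\<in>W. f v (C v)) \<le> (\<Sum>v\<in>insert q W. f v (B v)) + w ?e"
        using finW attach.hyps(3) by simp
      moreover have "f r (\<Union>v\<in>W. C v) \<le> (\<Sum>v\<in>W. f v (C v)) + sum w (K W C)"
        using attach.prems BX by (intro attach.IH) (auto simp: C_def)
      moreover have "(\<Union>v\<in>W. C v) = (\<Union>v\<in>insert q W. B v)"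
        using attach.hyps(2) by (auto simp: C_def split: if_splits)
      ultimately show ?thesis using wK by simp
    qed
  qed
  from this[OF grown_all[OF T r], of B] B
  have "f r (\<Union>v\<in>V. B v) \<le> (\<Sum>v\<in>V. f v (B v)) + sum w (K V B)" by simp
  moreover have "sum w (K V B) \<le> tree_div V E w (insert r {v \<in> V. B v \<noteq> {}})"
  proof -
    have sub: "insert r {v \<in> V. B v \<noteq> {}} \<subseteq> V" using r by auto
    show ?thesis unfolding tree_div_def span_edges_eq_separating[OF T sub]
      using finE w by (intro sum_mono2) (auto simp: K_def)
  qed
  ultimately show ?thesis by simp
qed

text \<open>
  The previous bound with root \<open>\<iota> x\<close> for some \<open>x \<in> Y\<close> and the set \<open>{y}\<close> at \<open>\<iota> y\<close> for each \<open>y \<in> Y\<close>: the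
  left side is \<open>\<delta> Y\<close>, and the values at the vertices vanish.
\<close>

lemma (in diversity) tight_tree_dominates:
  fixes f :: "'v \<Rightarrow> 'a set \<Rightarrow> real" and \<iota> :: "'a \<Rightarrow> 'v"
  assumes X: "finite X" and T: "finite_tree V E" and \<iota>: "inj_on \<iota> X" "\<iota> ` X \<subseteq> V"
    and f: "\<And>v. v \<in> V \<Longrightarrow> tight X \<delta> (f v)"
    and kappa: "\<And>x. x \<in> X \<Longrightarrow> f (\<iota> x) = kappa X \<delta> x"
    and w: "\<And>e. e \<in> E \<Longrightarrow> 0 \<le> w e"
    and lip: "\<And>u v A. {u, v} \<in> E \<Longrightarrow> A \<subseteq> X \<Longrightarrow> f u A \<le> f v A + w {u, v}"
    and Y: "Y \<subseteq> X"
  shows "\<delta> Y \<le> tree_div V E w (\<iota> ` Y)"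
proof (cases "Y = {}")
  case True
  have "\<delta> {} = 0" using zero_iff[of "{}"] by (simp add: Fpow_def)
  moreover have "0 \<le> tree_div V E w {}"
    using span_edges_eq_separating[OF T, of "{}"] by (simp add: tree_div_def)
  ultimately show ?thesis using True by simp
next
  case False
  then obtain x where x: "x \<in> Y" by auto
  define B where "B = (\<lambda>v. {y \<in> Y. \<iota> y = v})"
  have B_union: "(\<Union>v\<in>V. B v) = Y" using Y \<iota>(2) by (auto simp: B_def)
  have supp: "insert (\<iota> x) {v \<in> V. B v \<noteq> {}} = \<iota> ` Y" using x Y \<iota>(2) by (auto simp: B_def)
  have "f v (B v) = 0" if v: "v \<in> V" for v
  proof (cases "B v = {}")
    case True
    then show ?thesis using f[OF v] by (simp add: tight_def)
  next
    case False
    then obtain y where y: "y \<in> Y" "\<iota> y = v" by (auto simp: B_def)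
    then have "B v = {y}" using \<iota>(1) Y by (auto simp: B_def dest: inj_onD)
    then show ?thesis using kappa[of y] y Y zero_iff[of "{y}"] by (auto simp: kappa_def Fpow_def)
  qed
  then have zero: "(\<Sum>v\<in>V. f v (B v)) = 0" by simp
  have "\<delta> Y = f (\<iota> x) Y"
    using kappa[OF subsetD[OF Y x]] x Y X by (simp add: kappa_def Fpow_eq_Pow insert_absorb)
  also have "\<dots> \<le> (\<Sum>v\<in>V. f v (B v)) + tree_div V E w (\<iota> ` Y)"
  proof -
    have r: "\<iota> x \<in> V" using \<iota>(2) x Y by blast
    have BX: "B v \<subseteq> X" for v using Y by (auto simp: B_def)
    show ?thesis
      using tight_tree_bound[where f = f and w = w and B = B, OF X T r f w lip BX]
      unfolding B_union supp by simp
  qed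
  finally show ?thesis using zero by simp
qed


section \<open>Steiner solutions\<close>

theorem theorem6p3:
  fixes X :: "'a set" and \<delta> :: "'a set \<Rightarrow> real"
    and V :: "'a set" and E :: "'a set set" and w :: "'a set \<Rightarrow> real"
  assumes "diversity X \<delta>"
    and "finite X"
    and "steiner_solution X \<delta> V E w"
  shows "\<exists>\<phi>. \<phi> \<in> V \<rightarrow> tight_span X \<delta> \<and>
    (\<forall>x\<in>X. \<phi> x = kappa X \<delta> x) \<and>
    (\<forall>u v. {u, v} \<in> E \<longrightarrow> w {u, v} = tight_span_div X \<delta> {\<phi> u, \<phi> v})"
proof -
  interpret diversity X \<delta> by fact
  have T: "finite_tree V E" and w: "\<forall>e\<in>E. 0 \<le> w e" and XV: "X \<subseteq> V"
    and dom: "\<And>Y. Y \<subseteq> X \<Longrightarrow> \<delta> Y \<le> tree_div V E w Y"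
    and minimal: "\<And>(\<iota> :: 'a \<Rightarrow> nat) V' E' w'. steiner_feasible X \<delta> \<iota> V' E' w' \<Longrightarrow> sum w E \<le> sum w' E'"
    using assms(3) by (auto simp: steiner_solution_def steiner_feasible_def)
  have finV: "finite V" using T by (simp add: finite_tree_def)
  interpret dominating_semidiversity X \<delta> V "tree_div V E w"
    using finV XV semidiversity_tree_div[OF T w] dom by unfold_locales auto
  obtain \<phi> where \<phi>: "\<And>v. v \<in> V \<Longrightarrow> \<phi> v \<in> extensional (Pow X)"
    "\<And>v. v \<in> V \<Longrightarrow> tight X \<delta> (\<phi> v)"
    "\<And>x. x \<in> X \<Longrightarrow> \<phi> x = kappa X \<delta> x"
    "\<And>u v. u \<in> V \<Longrightarrow> v \<in> V \<Longrightarrow> tight_span_div X \<delta> {\<phi> u, \<phi> v} \<le> tree_div V E w {u, v}"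
    using exists_nonexpansive_extension by blast
  have edge: "u \<in> V \<and> v \<in> V" if "{u, v} \<in> E" for u v
    using finite_tree_edges[OF T that] by (auto simp: doubleton_eq_iff)
  define w' where "w' = (\<lambda>e. tight_span_div X \<delta> (\<phi> ` e))"
  have w'_le: "w' e \<le> w e" if e: "e \<in> E" for e
  proof -
    obtain u v where uv: "e = {u, v}" using finite_tree_edges[OF T e] by auto
    then show ?thesis
      using \<phi>(4)[of u v] edge[of u v] tree_div_edge_le[OF T w, of u v] e by (simp add: w'_def)
  qed
  obtain h :: "'a \<Rightarrow> nat" where h: "inj_on h V"
    using finite_imp_inj_to_nat_seg[OF finV] by blast
  define g where "g = the_inv_into V h"
  have g: "g (h v) = v" if "v \<in> V" for v unfolding g_def using the_inv_into_f_f[OF h that] .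
  let ?V = "h ` V" and ?E = "(`) h ` E" and ?w = "\<lambda>e. w' (g ` e)"
  have T': "finite_tree ?V ?E" using finite_tree_image[OF T h] .
  have gE: "g ` h ` e = e" if "e \<in> E" for e
    using finite_tree_edges[OF T that] g by auto
  have tight': "tight X \<delta> (\<phi> (g v))" if "v \<in> ?V" for v using that g \<phi>(2) by auto
  have lip: "\<phi> (g u) A \<le> \<phi> (g v) A + ?w {u, v}" if "{u, v} \<in> ?E" "A \<subseteq> X" for u v A
  proof -
    have "u \<in> ?V" using finite_tree_edges[OF T' that(1)] by (auto simp: doubleton_eq_iff)
    then show ?thesis
      using tight_diff_le_tight_span_div[OF assms(2) tight' that(2), of u "\<phi> (g v)"]
      by (simp add: w'_def)
  qed
  have w'_nonneg: "0 \<le> ?w e" if e: "e \<in> ?E" for e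
  proof -
    obtain u v where uv: "u \<in> ?V" "v \<in> ?V" "e = {u, v}" using finite_tree_edges[OF T' e] by blast
    then have "\<phi> (g u) {} = 0" "\<phi> (g v) {} = 0" using tight' by (auto simp: tight_def)
    then show ?thesis using lip[of u v "{}"] uv e by simp
  qed
  have hX: "inj_on h X" using h XV by (rule inj_on_subset)
  have "steiner_feasible X \<delta> h ?V ?E ?w"
    unfolding steiner_feasible_def
  proof (intro conjI allI impI ballI)
    have kappa': "\<phi> (g (h x)) = kappa X \<delta> x" if "x \<in> X" for x
      using that g \<phi>(3) XV by auto
    have hXV: "h ` X \<subseteq> ?V" using XV by auto
    show "\<delta> Y \<le> tree_div ?V ?E ?w (h ` Y)" if Y: "Y \<subseteq> X" for Y
      by (rule tight_tree_dominates[where f = "\<lambda>v. \<phi> (g v)", OF assms(2) T' hX hXV])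
        (use tight' kappa' w'_nonneg lip Y in auto)
  qed (use T' w'_nonneg hX XV in auto)
  then have "sum w E \<le> sum ?w ?E" by (rule minimal)
  also have "\<dots> = sum w' E"
  proof -
    have "inj_on ((`) h) E" using gE by (metis inj_onI)
    then have "sum ?w ?E = (\<Sum>e\<in>E. w' (g ` h ` e))" by (simp add: sum.reindex)
    also have "\<dots> = sum w' E" using gE by (intro sum.cong) auto
    finally show ?thesis .
  qed
  finally have "sum w' E = sum w E" using sum_mono[of E w' w, OF w'_le] by simp
  then have eq: "w' e = w e" if "e \<in> E" for e
    using sum_mono_inv[of w' E w e] w'_le that finite_tree_finite_edges[OF T] by blast
  show ?thesis
  proof (intro exI[of _ \<phi>] conjI allI impI ballI)
    show "\<phi> \<in> V \<rightarrow> tight_span X \<delta>" using tight_imp_tight_span[OF assms(2) \<phi>(2,1)] by auto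
    show "\<phi> x = kappa X \<delta> x" if "x \<in> X" for x using \<phi>(3)[OF that] .
    show "w {u, v} = tight_span_div X \<delta> {\<phi> u, \<phi> v}" if "{u, v} \<in> E" for u v
      using eq[OF that] by (simp add: w'_def)
  qed
qed

end
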